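(* Let $G$ be a countable discrete amenable group, $(V,\|\cdot\|)$ a complete semi-normed (real) vector space, and $\pi: G \to \mathrm{Isom}(V)$ a uniformly bounded representation. Let $S$ be the map sending $v\in V$ to the set map $S(v)$ given by $S(v)(F)=\sum_{g\in F}\pi(g^{-1})v$ for $F\in\mathcal{F}(G)$. Then $S$ is a linear isomorphism between $(V,\|\cdot\|)$ and $(\mathcal{M}_\oplus, |||\cdot|||_\infty)$. Moreover, if $\pi$ is isometric, then $S$ is an isometry.
   Context: $\mathcal{F}(G)$ is the set of non-empty finite subsets of $G$. $\mathrm{Isom}(V)$ denotes the group of bounded invertible linear operators on $V$ (not necessarily isometries); a representation is a group homomorphism $\pi:G\to\mathrm{Isom}(V)$; it is uniformly bounded if $C_\pi:=\sup_{g\in G}\|\pi(g)\|_{\mathrm{op}}<\infty$, and isometric if $C_\pi=1$, equivalently if each $\pi(g)$ is an isometry. A set map is a function $\varphi:\mathcal{F}(G)\to V$. It is $G$-equivariant if $\pi(g)\varphi(F)=\varphi(Fg^{-1})$ for all $g\in G$, $F\in\mathcal{F}(G)$. Put $|||\varphi|||_\infty:=\sup_{F\in\mathcal{F}(G)}\|\varphi(F)/|F|\|$; $\varphi$ is bounded if this is finite. $\mathcal{M}$ is the space of bounded and $G$-equivariant set maps; $\mathcal{M}_\oplus$ is the subspace of additive ones, i.e. $\varphi(E\sqcup F)=\varphi(E)+\varphi(F)$ for all disjoint $E,F\in\mathcal{F}(G)$. A linear isomorphism between semi-normed spaces means a linear bijection that is continuous with continuous inverse. *)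

theory Defs
  imports "HOL-Algebra.Coset" "HOL-Library.Countable_Set" "HOL-Library.FuncSet" Complex_Main
begin

section \<open>Amenability of discrete groups\<close>

text \<open>A discrete group is amenable if it carries a left-invariant finitely additive probability
  measure defined on all of its subsets.\<close>

definition amenable :: "('g, 'm) monoid_scheme \<Rightarrow> bool" where
  "amenable G \<longleftrightarrow> (\<exists>\<mu> :: 'g set \<Rightarrow> real.
     (\<forall>A\<subseteq>carrier G. 0 \<le> \<mu> A) \<and>
     \<mu> (carrier G) = 1 \<and>
     (\<forall>A B. A \<subseteq> carrier G \<and> B \<subseteq> carrier G \<and> A \<inter> B = {} \<longrightarrow> \<mu> (A \<union> B) = \<mu> A + \<mu> B) \<and>
     (\<forall>g\<in>carrier G. \<forall>A\<subseteq>carrier G. \<mu> (g <#\<^bsub>G\<^esub> A) = \<mu> A))"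

section \<open>Semi-normed spaces\<close>

definition seminorm :: "('v::real_vector \<Rightarrow> real) \<Rightarrow> bool" where
  "seminorm p \<longleftrightarrow>
     (\<forall>v. 0 \<le> p v) \<and> (\<forall>c v. p (c *\<^sub>R v) = \<bar>c\<bar> * p v) \<and> (\<forall>v w. p (v + w) \<le> p v + p w)"

text \<open>Limits need not be unique, since a non-zero vector may have semi-norm zero.\<close>

definition complete_seminorm :: "('v::real_vector \<Rightarrow> real) \<Rightarrow> bool" where
  "complete_seminorm p \<longleftrightarrow>
     (\<forall>X :: nat \<Rightarrow> 'v.
        (\<forall>e>0. \<exists>N. \<forall>m\<ge>N. \<forall>n\<ge>N. p (X m - X n) < e) \<longrightarrow>
        (\<exists>l. (\<lambda>n. p (X n - l)) \<longlonglongrightarrow> 0))"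

text \<open>A semi-normed space with explicit carrier and operations; this is needed because set maps
  do not form a type of class \<^class>\<open>real_vector\<close>.\<close>

record 'a semi_space = "'a partial_object" +
  vadd :: "'a \<Rightarrow> 'a \<Rightarrow> 'a"
  vscale :: "real \<Rightarrow> 'a \<Rightarrow> 'a"
  vnorm :: "'a \<Rightarrow> real"

definition space_of :: "('v::real_vector \<Rightarrow> real) \<Rightarrow> 'v semi_space" where
  "space_of p = \<lparr>carrier = UNIV, vadd = (+), vscale = (*\<^sub>R), vnorm = p\<rparr>"

definition vdist :: "'a semi_space \<Rightarrow> 'a \<Rightarrow> 'a \<Rightarrow> real" where
  "vdist X x y = vnorm X (vadd X x (vscale X (-1) y))"

definition linear_map :: "'a semi_space \<Rightarrow> 'b semi_space \<Rightarrow> ('a \<Rightarrow> 'b) \<Rightarrow> bool" where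
  "linear_map X Y T \<longleftrightarrow>
     T \<in> carrier X \<rightarrow> carrier Y \<and>
     (\<forall>x\<in>carrier X. \<forall>y\<in>carrier X. T (vadd X x y) = vadd Y (T x) (T y)) \<and>
     (\<forall>c. \<forall>x\<in>carrier X. T (vscale X c x) = vscale Y c (T x))"

definition continuous_on_spaces :: "'a semi_space \<Rightarrow> 'b semi_space \<Rightarrow> ('a \<Rightarrow> 'b) \<Rightarrow> bool" where
  "continuous_on_spaces X Y T \<longleftrightarrow>
     (\<forall>x\<in>carrier X. \<forall>e>0. \<exists>d>0. \<forall>y\<in>carrier X. vdist X y x < d \<longrightarrow> vdist Y (T y) (T x) < e)"

definition linear_isomorphism :: "'a semi_space \<Rightarrow> 'b semi_space \<Rightarrow> ('a \<Rightarrow> 'b) \<Rightarrow> bool" where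
  "linear_isomorphism X Y T \<longleftrightarrow>
     linear_map X Y T \<and> bij_betw T (carrier X) (carrier Y) \<and>
     continuous_on_spaces X Y T \<and> continuous_on_spaces Y X (inv_into (carrier X) T)"

definition isometry :: "'a semi_space \<Rightarrow> 'b semi_space \<Rightarrow> ('a \<Rightarrow> 'b) \<Rightarrow> bool" where
  "isometry X Y T \<longleftrightarrow>
     T \<in> carrier X \<rightarrow> carrier Y \<and>
     (\<forall>x\<in>carrier X. \<forall>y\<in>carrier X. vdist Y (T x) (T y) = vdist X x y)"

section \<open>Representations by bounded operators\<close>

definition bounded_operators :: "('v::real_vector \<Rightarrow> real) \<Rightarrow> ('v \<Rightarrow> 'v) monoid" where
  "bounded_operators p =
     \<lparr>carrier = {T. linear T \<and> (\<exists>c. \<forall>v. p (T v) \<le> c * p v)}, mult = (\<circ>), one = id\<rparr>"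

text \<open>Units of the monoid of bounded operators: both the operator and its inverse are bounded.\<close>

definition Isom :: "('v::real_vector \<Rightarrow> real) \<Rightarrow> ('v \<Rightarrow> 'v) monoid" where
  "Isom p = units_of (bounded_operators p)"

definition op_norm :: "('v::real_vector \<Rightarrow> real) \<Rightarrow> ('v \<Rightarrow> 'v) \<Rightarrow> real" where
  "op_norm p T = (SUP v\<in>{v. p v \<le> 1}. p (T v))"

definition group_representation ::
  "('g, 'm) monoid_scheme \<Rightarrow> ('v::real_vector \<Rightarrow> real) \<Rightarrow> ('g \<Rightarrow> 'v \<Rightarrow> 'v) \<Rightarrow> bool" where
  "group_representation G p \<pi> \<longleftrightarrow> \<pi> \<in> hom G (Isom p)"

definition uniformly_bounded ::
  "('g, 'm) monoid_scheme \<Rightarrow> ('v::real_vector \<Rightarrow> real) \<Rightarrow> ('g \<Rightarrow> 'v \<Rightarrow> 'v) \<Rightarrow> bool" where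
  "uniformly_bounded G p \<pi> \<longleftrightarrow> bdd_above ((\<lambda>g. op_norm p (\<pi> g)) ` carrier G)"

definition rep_const ::
  "('g, 'm) monoid_scheme \<Rightarrow> ('v::real_vector \<Rightarrow> real) \<Rightarrow> ('g \<Rightarrow> 'v \<Rightarrow> 'v) \<Rightarrow> real" where
  "rep_const G p \<pi> = (SUP g\<in>carrier G. op_norm p (\<pi> g))"

text \<open>For a uniformly bounded representation the two conditions are equivalent, except when the
  semi-norm vanishes identically: then every operator is an isometry, although its operator norm
  is zero. The disjunction also covers that case.\<close>

definition isometric_rep ::
  "('g, 'm) monoid_scheme \<Rightarrow> ('v::real_vector \<Rightarrow> real) \<Rightarrow> ('g \<Rightarrow> 'v \<Rightarrow> 'v) \<Rightarrow> bool" where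
  "isometric_rep G p \<pi> \<longleftrightarrow>
     rep_const G p \<pi> = 1 \<or> (\<forall>g\<in>carrier G. isometry (space_of p) (space_of p) (\<pi> g))"

lemma monoid_bounded_operators:
  assumes "seminorm p"
  shows "monoid (bounded_operators p)"
proof (rule monoidI, goal_cases)
  case (1 S T)
  then obtain c d where cd: "\<And>v. p (S v) \<le> c * p v" "\<And>v. p (T v) \<le> d * p v"
    and lin: "linear S" "linear T"
    by (auto simp: bounded_operators_def)
  have "p (S (T v)) \<le> (\<bar>c\<bar> * d) * p v" for v
  proof -
    have pos: "0 \<le> p w" for w
      using assms by (simp add: seminorm_def)
    have "p (S (T v)) \<le> \<bar>c\<bar> * p (T v)"
      by (rule order_trans[OF cd(1)]) (intro mult_right_mono pos, simp)
    also have "\<dots> \<le> \<bar>c\<bar> * (d * p v)"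
      by (intro mult_left_mono cd(2)) simp
    finally show ?thesis by (simp add: mult.assoc)
  qed
  with lin show ?case
    by (auto simp: bounded_operators_def intro: linear_compose)
next
  case 2
  have "\<exists>c. \<forall>v. p v \<le> c * p v" by (rule exI[of _ 1]) simp
  then show ?case by (simp add: bounded_operators_def linear_id)
qed (auto simp: bounded_operators_def)

lemma group_Isom: "seminorm p \<Longrightarrow> group (Isom p)"
  unfolding Isom_def by (intro monoid.units_group monoid_bounded_operators)

section \<open>Set maps\<close>

definition finite_subsets :: "('g, 'm) monoid_scheme \<Rightarrow> 'g set set" where
  "finite_subsets G = {F. F \<subseteq> carrier G \<and> finite F \<and> F \<noteq> {}}"

text \<open>Set maps are represented as extensional functions (\<^const>\<open>undefined\<close> off
  \<^const>\<open>finite_subsets\<close>), so that equality of set maps is equality in HOL.\<close>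

definition set_maps :: "('g, 'm) monoid_scheme \<Rightarrow> ('g set \<Rightarrow> 'v) set" where
  "set_maps G = finite_subsets G \<rightarrow>\<^sub>E UNIV"

definition equivariant ::
  "('g, 'm) monoid_scheme \<Rightarrow> ('g \<Rightarrow> 'v \<Rightarrow> 'v) \<Rightarrow> ('g set \<Rightarrow> 'v) \<Rightarrow> bool" where
  "equivariant G \<pi> \<phi> \<longleftrightarrow>
     (\<forall>g\<in>carrier G. \<forall>F\<in>finite_subsets G. \<pi> g (\<phi> F) = \<phi> (F #>\<^bsub>G\<^esub> inv\<^bsub>G\<^esub> g))"

definition bounded_set_map ::
  "('g, 'm) monoid_scheme \<Rightarrow> ('v::real_vector \<Rightarrow> real) \<Rightarrow> ('g set \<Rightarrow> 'v) \<Rightarrow> bool" where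
  "bounded_set_map G p \<phi> \<longleftrightarrow>
     bdd_above ((\<lambda>F. p (\<phi> F /\<^sub>R real (card F))) ` finite_subsets G)"

definition additive_set_map ::
  "('g, 'm) monoid_scheme \<Rightarrow> ('g set \<Rightarrow> 'v::real_vector) \<Rightarrow> bool" where
  "additive_set_map G \<phi> \<longleftrightarrow>
     (\<forall>E\<in>finite_subsets G. \<forall>F\<in>finite_subsets G. E \<inter> F = {} \<longrightarrow> \<phi> (E \<union> F) = \<phi> E + \<phi> F)"

definition sup_norm ::
  "('g, 'm) monoid_scheme \<Rightarrow> ('v::real_vector \<Rightarrow> real) \<Rightarrow> ('g set \<Rightarrow> 'v) \<Rightarrow> real" where
  "sup_norm G p \<phi> = (SUP F\<in>finite_subsets G. p (\<phi> F /\<^sub>R real (card F)))"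

definition M_space ::
  "('g, 'm) monoid_scheme \<Rightarrow> ('v::real_vector \<Rightarrow> real) \<Rightarrow> ('g \<Rightarrow> 'v \<Rightarrow> 'v) \<Rightarrow>
     ('g set \<Rightarrow> 'v) semi_space" where
  "M_space G p \<pi> =
     \<lparr>carrier = {\<phi> \<in> set_maps G. bounded_set_map G p \<phi> \<and> equivariant G \<pi> \<phi>},
      vadd = (\<lambda>\<phi> \<psi>. \<lambda>F\<in>finite_subsets G. \<phi> F + \<psi> F),
      vscale = (\<lambda>c \<phi>. \<lambda>F\<in>finite_subsets G. c *\<^sub>R \<phi> F),
      vnorm = sup_norm G p\<rparr>"

definition M_add_space ::
  "('g, 'm) monoid_scheme \<Rightarrow> ('v::real_vector \<Rightarrow> real) \<Rightarrow> ('g \<Rightarrow> 'v \<Rightarrow> 'v) \<Rightarrow>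
     ('g set \<Rightarrow> 'v) semi_space" where
  "M_add_space G p \<pi> =
     (M_space G p \<pi>)\<lparr>carrier := {\<phi> \<in> carrier (M_space G p \<pi>). additive_set_map G \<phi>}\<rparr>"

definition S_map ::
  "('g, 'm) monoid_scheme \<Rightarrow> ('g \<Rightarrow> 'v \<Rightarrow> 'v) \<Rightarrow> 'v \<Rightarrow> ('g set \<Rightarrow> 'v::real_vector)" where
  "S_map G \<pi> v = (\<lambda>F\<in>finite_subsets G. \<Sum>g\<in>F. \<pi> (inv\<^bsub>G\<^esub> g) v)"

end

theory Submission
  imports Defs
begin

text \<open>
  Equivariance lets a set map be read off at the identity: if \<open>\<phi>\<close> is equivariant then
  \<open>\<phi> {g} = \<pi> (inv g) (\<phi> {1})\<close>, and an additive map is determined by its values on singletons, so an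
  additive equivariant \<open>\<phi>\<close> is \<open>S v\<close> with \<open>v = \<phi> {1}\<close>. Conversely every \<open>S v\<close> is additive, and it is
  equivariant because translating \<open>F\<close> by \<open>inv g\<close> on the right only reindexes the defining sum.
  Hence \<open>S\<close> is a linear bijection with inverse \<open>\<phi> \<mapsto> \<phi> {1}\<close>.

  Both continuity claims come from the two-sided estimate
  \<open>p v \<le> |||S v||| \<le> C * p v\<close>, where \<open>C\<close> is any constant with \<open>p (\<pi> g v) \<le> C * p v\<close>
  for all \<open>g\<close>: the lower bound is the value at the singleton \<open>{1}\<close>, the upper bound is the triangle
  inequality for an average of vectors \<open>\<pi> (inv g) v\<close>. The constant \<open>rep_const G p \<pi>\<close> is always such
  a \<open>C\<close>. For an isometric representation \<open>C = 1\<close> works, and the two bounds coincide.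
\<close>

section \<open>Operator bounds for a semi-norm\<close>

lemma seminorm_zero: "seminorm p \<Longrightarrow> p 0 = 0"
  unfolding seminorm_def by (metis abs_zero mult_zero_left scaleR_zero_left)

lemma seminorm_sum_le:
  assumes "seminorm p" and "finite A"
  shows "p (\<Sum>a\<in>A. f a) \<le> (\<Sum>a\<in>A. p (f a))"
  using assms(2)
proof (induction A rule: finite_induct)
  case empty
  then show ?case using seminorm_zero[OF assms(1)] by simp
next
  case (insert a A)
  have "p (f a + sum f A) \<le> p (f a) + p (sum f A)"
    using assms(1) by (simp add: seminorm_def)
  with insert show ?case by simp
qed

text \<open>On vectors of non-zero semi-norm this is rescaling to the unit ball. On the kernel of the
  semi-norm rescaling is impossible; there boundedness itself forces \<open>T v\<close> into the kernel.\<close>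

lemma op_norm_bound:
  assumes p: "seminorm p" and T: "T \<in> carrier (bounded_operators p)"
  shows "p (T v) \<le> op_norm p T * p v"
proof -
  from T obtain c where lin: "linear T" and c: "\<And>v. p (T v) \<le> c * p v"
    by (auto simp: bounded_operators_def)
  have pos: "0 \<le> p w" and scale: "p (r *\<^sub>R w) = \<bar>r\<bar> * p w" for r w
    using p by (auto simp: seminorm_def)
  show ?thesis
  proof (cases "p v = 0")
    case True
    then show ?thesis using c[of v] by simp
  next
    case False
    have bdd: "bdd_above ((\<lambda>v. p (T v)) ` {v. p v \<le> 1})"
    proof (rule bdd_aboveI2)
      fix w assume "w \<in> {v. p v \<le> 1}"
      then have "\<bar>c\<bar> * p w \<le> \<bar>c\<bar>"
        using mult_left_mono[of "p w" 1 "\<bar>c\<bar>"] by simp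
      moreover have "c * p w \<le> \<bar>c\<bar> * p w"
        by (intro mult_right_mono pos) simp
      ultimately show "p (T w) \<le> \<bar>c\<bar>" using c[of w] by linarith
    qed
    have "0 < p v" using False pos[of v] by linarith
    then have "p (T (inverse (p v) *\<^sub>R v)) \<le> op_norm p T"
      unfolding op_norm_def by (intro cSUP_upper[OF _ bdd]) (simp add: scale)
    then show ?thesis
      using \<open>0 < p v\<close> by (simp add: linear_scale[OF lin] scale field_simps)
  qed
qed

section \<open>Linear maps with two-sided norm bounds\<close>

lemma linear_map_vdist:
  assumes "linear_map X Y T" and "x \<in> carrier X" "y \<in> carrier X"
    and "vscale X (-1) y \<in> carrier X"
  shows "vdist Y (T x) (T y) = vnorm Y (T (vadd X x (vscale X (-1) y)))"
  using assms by (simp add: vdist_def linear_map_def)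

lemma lipschitz_imp_continuous_on_spaces:
  assumes "\<And>x y. x \<in> carrier X \<Longrightarrow> y \<in> carrier X \<Longrightarrow> vdist Y (T x) (T y) \<le> C * vdist X x y"
    and "\<And>x y. x \<in> carrier X \<Longrightarrow> y \<in> carrier X \<Longrightarrow> 0 \<le> vdist X x y"
  shows "continuous_on_spaces X Y T"
  unfolding continuous_on_spaces_def
proof (intro ballI allI impI)
  fix x and e :: real assume x: "x \<in> carrier X" and e: "0 < e"
  \<comment> \<open>\<open>C\<close> may be zero or negative, so it is enlarged before dividing by it.\<close>
  define K where "K = \<bar>C\<bar> + 1"
  have K: "0 < K" "C \<le> K" by (auto simp: K_def)
  have "vdist Y (T y) (T x) < e" if y: "y \<in> carrier X" and d: "vdist X y x < e / K" for y
  proof -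
    have "vdist Y (T y) (T x) \<le> C * vdist X y x" using assms(1) x y by blast
    also have "\<dots> \<le> K * vdist X y x" using K assms(2)[OF y x] by (intro mult_right_mono)
    also have "\<dots> < e" using d K by (simp add: field_simps)
    finally show ?thesis .
  qed
  then show "\<exists>d>0. \<forall>y\<in>carrier X. vdist X y x < d \<longrightarrow> vdist Y (T y) (T x) < e"
    using e K by (intro exI[of _ "e / K"]) auto
qed

section \<open>The map \<open>S\<close> of a uniformly bounded representation\<close>

locale uniformly_bounded_rep = group G
  for G (structure) +
  fixes p :: "'v::real_vector \<Rightarrow> real" and \<pi> :: "'a \<Rightarrow> 'v \<Rightarrow> 'v"
  assumes p: "seminorm p" and rep: "group_representation G p \<pi>"
    and ub: "uniformly_bounded G p \<pi>"
begin

lemma p_nonneg: "0 \<le> p v" and p_scale: "p (c *\<^sub>R v) = \<bar>c\<bar> * p v"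
  using p by (auto simp: seminorm_def)

lemma rep_bounded_operator: "g \<in> carrier G \<Longrightarrow> \<pi> g \<in> carrier (bounded_operators p)"
  using rep by (auto simp: group_representation_def hom_def Isom_def units_of_def Units_def)

lemma rep_linear: "g \<in> carrier G \<Longrightarrow> linear (\<pi> g)"
  using rep_bounded_operator by (auto simp: bounded_operators_def)

lemma rep_mult: "g \<in> carrier G \<Longrightarrow> h \<in> carrier G \<Longrightarrow> \<pi> (g \<otimes> h) v = \<pi> g (\<pi> h v)"
  using rep by (auto simp: group_representation_def hom_def Isom_def units_of_def bounded_operators_def)

lemma rep_one: "\<pi> \<one> = id"
  using hom_one[OF rep[unfolded group_representation_def] is_group group_Isom[OF p]]
  by (simp add: Isom_def units_of_def bounded_operators_def)

lemma rep_const_bound: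
  assumes "g \<in> carrier G"
  shows "p (\<pi> g v) \<le> rep_const G p \<pi> * p v"
proof -
  have "op_norm p (\<pi> g) \<le> rep_const G p \<pi>"
    unfolding rep_const_def using assms ub by (intro cSUP_upper) (auto simp: uniformly_bounded_def)
  then have "op_norm p (\<pi> g) * p v \<le> rep_const G p \<pi> * p v"
    by (intro mult_right_mono p_nonneg)
  with op_norm_bound[OF p rep_bounded_operator[OF assms], of v] show ?thesis by linarith
qed

lemma isometric_rep_contracts:
  assumes "isometric_rep G p \<pi>" and "g \<in> carrier G"
  shows "p (\<pi> g v) \<le> 1 * p v"
  using assms(1) unfolding isometric_rep_def
proof
  assume "rep_const G p \<pi> = 1"
  then show ?thesis using rep_const_bound[OF assms(2)] by simp
next
  assume "\<forall>g\<in>carrier G. isometry (space_of p) (space_of p) (\<pi> g)"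
  \<comment> \<open>Distance preservation, applied to the pair \<open>v\<close> and \<open>0\<close>.\<close>
  then have "vdist (space_of p) (\<pi> g v) (\<pi> g 0) = vdist (space_of p) v 0"
    using assms(2) by (simp add: isometry_def space_of_def)
  then show ?thesis
    using linear_0[OF rep_linear[OF assms(2)]] by (simp add: vdist_def space_of_def)
qed

lemma singleton_finite_subset: "g \<in> carrier G \<Longrightarrow> {g} \<in> finite_subsets G"
  by (simp add: finite_subsets_def)

lemma S_map_one: "S_map G \<pi> v {\<one>} = v"
  using singleton_finite_subset[OF one_closed] rep_one by (simp add: S_map_def)

lemma S_map_average_le:
  assumes C: "\<And>g. g \<in> carrier G \<Longrightarrow> p (\<pi> g v) \<le> C * p v" and F: "F \<in> finite_subsets G"
  shows "p (S_map G \<pi> v F /\<^sub>R real (card F)) \<le> C * p v"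
proof -
  have fin: "finite F" and sub: "F \<subseteq> carrier G" and ne: "0 < card F"
    using F by (auto simp: finite_subsets_def card_gt_0_iff)
  have "p (S_map G \<pi> v F) \<le> (\<Sum>g\<in>F. p (\<pi> (inv g) v))"
    using F seminorm_sum_le[OF p fin] by (simp add: S_map_def)
  also have "\<dots> \<le> (\<Sum>g\<in>F. C * p v)"
    using sub by (intro sum_mono C) auto
  finally show ?thesis using ne by (simp add: p_scale field_simps)
qed

lemma S_map_bounded: "bounded_set_map G p (S_map G \<pi> v)"
  unfolding bounded_set_map_def
  by (rule bdd_aboveI2[where M = "rep_const G p \<pi> * p v"]) (intro S_map_average_le rep_const_bound)

lemma sup_norm_S_map_le:
  assumes "\<And>g. g \<in> carrier G \<Longrightarrow> p (\<pi> g v) \<le> C * p v"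
  shows "sup_norm G p (S_map G \<pi> v) \<le> C * p v"
  unfolding sup_norm_def
  using singleton_finite_subset[OF one_closed] S_map_average_le[OF assms]
  by (intro cSUP_least) auto

lemma sup_norm_S_map_ge: "p v \<le> sup_norm G p (S_map G \<pi> v)"
proof -
  have "p (S_map G \<pi> v {\<one>} /\<^sub>R real (card {\<one>})) \<le> sup_norm G p (S_map G \<pi> v)"
    unfolding sup_norm_def
    by (rule cSUP_upper[OF singleton_finite_subset[OF one_closed]])
      (rule S_map_bounded[unfolded bounded_set_map_def])
  then show ?thesis by (simp add: S_map_one)
qed

lemma r_coset_inv_image: "F #> inv g = (\<lambda>h. h \<otimes> inv g) ` F"
  by (auto simp: r_coset_def)

text \<open>Right translation by \<open>inv g\<close> is injective, so \<open>S v\<close> at the translated set is the sum over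
  \<open>h \<in> F\<close> of \<open>\<pi> (inv (h \<otimes> inv g)) v\<close>, and \<open>inv (h \<otimes> inv g) = g \<otimes> inv h\<close>.\<close>

lemma S_map_equivariant: "equivariant G \<pi> (S_map G \<pi> v)"
  unfolding equivariant_def
proof (intro ballI)
  fix g F assume g: "g \<in> carrier G" and F: "F \<in> finite_subsets G"
  have sub: "F \<subseteq> carrier G" using F by (simp add: finite_subsets_def)
  have Fg: "F #> inv g \<in> finite_subsets G"
    using F g by (auto simp: finite_subsets_def r_coset_inv_image)
  have inj: "inj_on (\<lambda>h. h \<otimes> inv g) F"
    using sub g by (intro inj_onI) (auto simp: subset_iff right_cancel)
  have "S_map G \<pi> v (F #> inv g) = (\<Sum>h\<in>F. \<pi> (inv (h \<otimes> inv g)) v)"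
    using Fg by (simp add: S_map_def r_coset_inv_image sum.reindex[OF inj])
  also have "\<dots> = (\<Sum>h\<in>F. \<pi> g (\<pi> (inv h) v))"
    using sub g by (intro sum.cong refl) (auto simp: inv_mult_group rep_mult subset_iff)
  also have "\<dots> = \<pi> g (S_map G \<pi> v F)"
    using F by (simp add: S_map_def linear_sum[OF rep_linear[OF g]])
  finally show "\<pi> g (S_map G \<pi> v F) = S_map G \<pi> v (F #> inv g)" by simp
qed

lemma S_map_additive: "additive_set_map G (S_map G \<pi> v)"
  by (auto simp: additive_set_map_def S_map_def finite_subsets_def sum.union_disjoint)

lemma S_map_in_carrier: "S_map G \<pi> v \<in> carrier (M_add_space G p \<pi>)"
  using S_map_bounded S_map_equivariant S_map_additive
  by (auto simp: M_add_space_def M_space_def set_maps_def S_map_def)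

lemma S_map_surj:
  assumes "\<phi> \<in> carrier (M_add_space G p \<pi>)"
  shows "S_map G \<pi> (\<phi> {\<one>}) = \<phi>"
proof
  have ext: "\<phi> \<in> set_maps G" and eq: "equivariant G \<pi> \<phi>" and add: "additive_set_map G \<phi>"
    using assms by (auto simp: M_add_space_def M_space_def)
  \<comment> \<open>\<open>{g}\<close> is the translate of \<open>{1}\<close> by the inverse of \<open>inv g\<close>.\<close>
  have single: "\<phi> {g} = \<pi> (inv g) (\<phi> {\<one>})" if g: "g \<in> carrier G" for g
  proof -
    have "\<pi> (inv g) (\<phi> {\<one>}) = \<phi> ({\<one>} #> inv (inv g))"
      using eq g singleton_finite_subset[OF one_closed] by (simp add: equivariant_def)
    then show ?thesis using g by (simp add: r_coset_def)
  qed
  have sum: "F \<subseteq> carrier G \<Longrightarrow> \<phi> F = (\<Sum>g\<in>F. \<phi> {g})" if "finite F" "F \<noteq> {}" for F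
    using that
  proof (induction F rule: finite_ne_induct)
    case (singleton g)
    then show ?case by simp
  next
    case (insert g F)
    then have "\<phi> ({g} \<union> F) = \<phi> {g} + \<phi> F"
      by (intro add[unfolded additive_set_map_def, rule_format])
        (auto simp: finite_subsets_def)
    with insert show ?case by simp
  qed
  fix F
  show "S_map G \<pi> (\<phi> {\<one>}) F = \<phi> F"
  proof (cases "F \<in> finite_subsets G")
    case True
    then have "\<phi> F = (\<Sum>g\<in>F. \<phi> {g})" using sum by (simp add: finite_subsets_def)
    also have "\<dots> = (\<Sum>g\<in>F. \<pi> (inv g) (\<phi> {\<one>}))"
      using True by (intro sum.cong refl single) (auto simp: finite_subsets_def)
    finally show ?thesis using True by (simp add: S_map_def)
  next
    case False
    then show ?thesis using ext by (auto simp: S_map_def set_maps_def PiE_def extensional_def)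
  qed
qed

lemma S_map_linear: "linear_map (space_of p) (M_add_space G p \<pi>) (S_map G \<pi>)"
proof -
  have lin: "F \<in> finite_subsets G \<Longrightarrow> g \<in> F \<Longrightarrow> linear (\<pi> (inv g))" for F g
    by (intro rep_linear) (auto simp: finite_subsets_def)
  have "S_map G \<pi> (x + y) = (\<lambda>F\<in>finite_subsets G. S_map G \<pi> x F + S_map G \<pi> y F)" for x y
    by (auto simp: S_map_def fun_eq_iff restrict_def linear_add[OF lin] sum.distrib[symmetric]
        intro!: sum.cong)
  moreover have "S_map G \<pi> (c *\<^sub>R x) = (\<lambda>F\<in>finite_subsets G. c *\<^sub>R S_map G \<pi> x F)" for c x
    by (auto simp: S_map_def fun_eq_iff restrict_def linear_scale[OF lin] scaleR_sum_right
        intro!: sum.cong)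
  ultimately show ?thesis
    using S_map_in_carrier by (auto simp: linear_map_def space_of_def M_add_space_def M_space_def)
qed

lemma S_map_bij: "bij_betw (S_map G \<pi>) (carrier (space_of p)) (carrier (M_add_space G p \<pi>))"
  by (rule bij_betwI[where g = "\<lambda>\<phi>. \<phi> {\<one>}"])
    (auto simp: space_of_def S_map_in_carrier S_map_one S_map_surj)

lemma vdist_space_of: "vdist (space_of p) x y = p (x - y)"
  by (simp add: vdist_def space_of_def)

lemma vdist_S_map:
  "vdist (M_add_space G p \<pi>) (S_map G \<pi> x) (S_map G \<pi> y) = sup_norm G p (S_map G \<pi> (x - y))"
  by (subst linear_map_vdist[OF S_map_linear])
    (auto simp: space_of_def M_add_space_def M_space_def)

lemma S_map_linear_isomorphism:
  "linear_isomorphism (space_of p) (M_add_space G p \<pi>) (S_map G \<pi>)"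
proof -
  let ?X = "space_of p" and ?Y = "M_add_space G p \<pi>"
  let ?S = "S_map G \<pi>" and ?I = "inv_into (carrier (space_of p)) (S_map G \<pi>)"
  have "continuous_on_spaces ?X ?Y ?S"
    by (rule lipschitz_imp_continuous_on_spaces[where C = "rep_const G p \<pi>"])
      (auto simp: vdist_S_map vdist_space_of p_nonneg intro!: sup_norm_S_map_le rep_const_bound)
  moreover have "continuous_on_spaces ?Y ?X ?I"
  proof (rule lipschitz_imp_continuous_on_spaces[where C = 1])
    fix \<phi> \<psi> assume "\<phi> \<in> carrier ?Y" "\<psi> \<in> carrier ?Y"
    then have S: "?S (?I \<phi>) = \<phi>" "?S (?I \<psi>) = \<psi>"
      using bij_betw_inv_into_right[OF S_map_bij] by auto
    have "vdist ?Y \<phi> \<psi> = sup_norm G p (?S (?I \<phi> - ?I \<psi>))"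
      using vdist_S_map[of "?I \<phi>" "?I \<psi>"] unfolding S .
    moreover have "vdist ?X (?I \<phi>) (?I \<psi>) = p (?I \<phi> - ?I \<psi>)" by (rule vdist_space_of)
    ultimately show "vdist ?X (?I \<phi>) (?I \<psi>) \<le> 1 * vdist ?Y \<phi> \<psi>" "0 \<le> vdist ?Y \<phi> \<psi>"
      using sup_norm_S_map_ge[of "?I \<phi> - ?I \<psi>"] p_nonneg[of "?I \<phi> - ?I \<psi>"] by simp_all
  qed
  ultimately show ?thesis
    unfolding linear_isomorphism_def using S_map_linear S_map_bij by blast
qed

lemma S_map_isometry:
  assumes "isometric_rep G p \<pi>"
  shows "isometry (space_of p) (M_add_space G p \<pi>) (S_map G \<pi>)"
proof -
  have "sup_norm G p (S_map G \<pi> v) = p v" for v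
    using sup_norm_S_map_le[OF isometric_rep_contracts[OF assms], of v] sup_norm_S_map_ge[of v]
    by simp
  then show ?thesis
    by (auto simp: isometry_def vdist_S_map vdist_space_of S_map_in_carrier)
qed

end

theorem proposition3p1:
  fixes G :: "('g, 'm) monoid_scheme"
    and p :: "'v::real_vector \<Rightarrow> real"
    and \<pi> :: "'g \<Rightarrow> 'v \<Rightarrow> 'v"
  assumes "group G" and "countable (carrier G)" and "amenable G"
    and "seminorm p" and "complete_seminorm p"
    and "group_representation G p \<pi>" and "uniformly_bounded G p \<pi>"
  shows "linear_isomorphism (space_of p) (M_add_space G p \<pi>) (S_map G \<pi>) \<and>
         (isometric_rep G p \<pi> \<longrightarrow> isometry (space_of p) (M_add_space G p \<pi>) (S_map G \<pi>))"
proof -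
  interpret uniformly_bounded_rep G p \<pi>
    using assms by (simp add: uniformly_bounded_rep_def uniformly_bounded_rep_axioms_def)
  show ?thesis using S_map_linear_isomorphism S_map_isometry by blast
qed

end
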